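(* Suppose that for each $i\in I$ there are $\theta_i\in(0,1]$ and $H_i>0$ with $\|\nabla f_i(x)-\nabla f_i(y)\|\le H_i\|y-x\|^{\theta_i}$ for all $x,y\in\Omega$, and that there exists $f_i^*\in\mathbb{R}$ such that $f_i(x)\ge f_i^*$ for all $x\in\Omega$. Let $\theta_{\min}=\min_{i\in I}\theta_i$, and let $\{x_k\}_{k\ge0}$ be generated by the Metropolis-Based Nonmonotone Line Search Method with $\gamma>1$ and $\tau_k=1/\ln(k+1)$ (with the convention $1/\tau_0=\ln 1=0$). Then the method takes at most $\mathcal{O}\left(\epsilon^{-\left(1+\frac1{\theta_{\min}}\right)}\right)$ iterations to find an $\epsilon$-approximate Pareto critical point; that is, there is a constant $C>0$, depending only on $c_1,c_2,\beta,\rho,\gamma$ and on $\sigma_i$, $\theta_i$, $H_i$, $f_i(x_0)-f_i^*$ ($i\in I$), such that for every $\epsilon\in(0,1)$ and every $T$ with $\|s(x_k)\|>\epsilon$ for $k=0,\ldots,T-1$ one has $$T\le C\,\epsilon^{-\left(1+\frac1{\theta_{\min}}\right)}.$$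
   Context: Setting: $\emptyset\ne\Omega\subset\mathbb{R}^n$ is closed and convex, $F=(f_1,\ldots,f_m)^T:\mathbb{R}^n\to\mathbb{R}^m$ is continuously differentiable (possibly nonconvex), $I=\{1,\ldots,m\}$, $\|\cdot\|$ is the Euclidean norm, $\mathbb{R}^m_+=\{z\in\mathbb{R}^m: z_i\ge0,\ i\in I\}$. For $x\in\Omega$, $\Omega-x=\{y\in\mathbb{R}^n: y+x\in\Omega\}$, and $s(x)$ is the unique minimizer over $d\in\Omega-x$ of $\max_{i\in I}\{\nabla f_i(x)^Td\}+\frac12\|d\|^2$. A point $x\in\Omega$ is an $\epsilon$-approximate Pareto critical point when $\|s(x)\|\le\epsilon$. Metropolis-Based Nonmonotone Line Search Method. Parameters: $x_0\in\Omega$, $\beta,\rho\in(0,1)$, $c_1,c_2>0$, $\sigma\in\mathbb{R}^m_+$, $\gamma>0$, and a sequence $\{\tau_k\}_{k\ge0}$ of positive numbers with $\tau_k\to0$. At each iteration $k=0,1,2,\ldots$: (Step 1) choose $d(x_k)\in\Omega-x_k$ with $\max_{i\in I}\{\nabla f_i(x_k)^Td(x_k)\}\le-c_1\|s(x_k)\|^2$ and $\|d(x_k)\|\le c_2\|s(x_k)\|$. (Step 2) For $\ell=0,1,2,\ldots$ put $x_{k,\ell}^+=x_k+\beta^\ell d(x_k)$ and $$[\nu_{k,\ell}]_i=\sigma_i\exp\left(-\frac{\max\{\gamma,\ f_i(x_{k,\ell}^+)-f_i(x_k)\}}{\tau_k}\right),\quad i\in I,$$ and let $\ell_k$ be the first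 $\ell$ such that $f_i(x_{k,\ell}^+)\le f_i(x_k)+\rho\beta^\ell\nabla f_i(x_k)^Td(x_k)+[\nu_{k,\ell}]_i$ for all $i\in I$. (Step 3) Set $\nu_k=\nu_{k,\ell_k}$, $\alpha_k=\beta^{\ell_k}$, $x_{k+1}=x_{k,\ell_k}^+$. *)

theory Defs
  imports "HOL-Analysis.Analysis" "HOL-Library.Poly_Mapping"
begin

section \<open>Finitely supported functions as an inner product space\<close>

text \<open>
  The complexity constant must not depend on the dimension n, so n has to be
  quantified inside the formula. All the spaces of n-tuples are therefore realised
  inside one type, the finitely supported real sequences with the inner product
  "sum of x(k) y(k)"; n-space is the subspace of sequences vanishing from index n on.
\<close>

instantiation poly_mapping :: (type, real_vector) real_vector
begin

lift_definition scaleR_poly_mapping :: "real \<Rightarrow> ('a \<Rightarrow>\<^sub>0 'b) \<Rightarrow> ('a \<Rightarrow>\<^sub>0 'b)"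
  is "\<lambda>r x k. r *\<^sub>R x k"
  by (rule finite_subset) auto

instance
  by standard
    (rule poly_mapping_eqI; simp add: scaleR_poly_mapping.rep_eq lookup_add
      scaleR_add_right scaleR_add_left)+

end

instantiation poly_mapping :: (type, real_inner) real_inner
begin

definition inner_poly_mapping :: "('a \<Rightarrow>\<^sub>0 'b) \<Rightarrow> ('a \<Rightarrow>\<^sub>0 'b) \<Rightarrow> real"
  where "inner_poly_mapping x y =
    (\<Sum>k \<in> Poly_Mapping.keys x. inner (Poly_Mapping.lookup x k) (Poly_Mapping.lookup y k))"

definition norm_poly_mapping :: "('a \<Rightarrow>\<^sub>0 'b) \<Rightarrow> real"
  where "norm_poly_mapping x = sqrt (inner x x)"

definition dist_poly_mapping :: "('a \<Rightarrow>\<^sub>0 'b) \<Rightarrow> ('a \<Rightarrow>\<^sub>0 'b) \<Rightarrow> real"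
  where "dist_poly_mapping x y = norm (x - y)"

definition sgn_poly_mapping :: "('a \<Rightarrow>\<^sub>0 'b) \<Rightarrow> ('a \<Rightarrow>\<^sub>0 'b)"
  where "sgn_poly_mapping x = x /\<^sub>R norm x"

definition uniformity_poly_mapping :: "(('a \<Rightarrow>\<^sub>0 'b) \<times> ('a \<Rightarrow>\<^sub>0 'b)) filter"
  where "uniformity_poly_mapping =
    (INF e\<in>{0 <..}. principal {(x, y). dist (x :: 'a \<Rightarrow>\<^sub>0 'b) y < e})"

definition open_poly_mapping :: "('a \<Rightarrow>\<^sub>0 'b) set \<Rightarrow> bool"
  where "open_poly_mapping U \<longleftrightarrow>
    (\<forall>x\<in>U. \<forall>\<^sub>F (x', y) in uniformity. (x' :: 'a \<Rightarrow>\<^sub>0 'b) = x \<longrightarrow> y \<in> U)"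

lemma inner_poly_mapping_superset:
  fixes x y :: "'a \<Rightarrow>\<^sub>0 'b"
  assumes "finite A" "Poly_Mapping.keys x \<subseteq> A"
  shows "inner x y = (\<Sum>k\<in>A. inner (Poly_Mapping.lookup x k) (Poly_Mapping.lookup y k))"
  unfolding inner_poly_mapping_def
  by (rule sum.mono_neutral_left) (use assms in \<open>auto simp: in_keys_iff\<close>)

instance
proof
  fix x y z :: "'a \<Rightarrow>\<^sub>0 'b" and r :: real
  let ?A = "Poly_Mapping.keys x \<union> Poly_Mapping.keys y"
  have fin: "finite ?A" by simp
  show "sgn x = x /\<^sub>R norm x"
    by (rule sgn_poly_mapping_def)
  show "dist x y = norm (x - y)"
    by (rule dist_poly_mapping_def)
  show "(uniformity :: (('a \<Rightarrow>\<^sub>0 'b) \<times> ('a \<Rightarrow>\<^sub>0 'b)) filter) =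
      (INF e\<in>{0 <..}. principal {(x, y). dist x y < e})"
    by (rule uniformity_poly_mapping_def)
  show "open U = (\<forall>x\<in>U. \<forall>\<^sub>F (x', y) in uniformity. x' = x \<longrightarrow> y \<in> U)"
    for U :: "('a \<Rightarrow>\<^sub>0 'b) set"
    by (rule open_poly_mapping_def)
  show "inner x y = inner y x"
    unfolding inner_poly_mapping_superset[OF fin Un_upper1, of y]
      inner_poly_mapping_superset[OF fin Un_upper2, of x]
    by (simp only: inner_commute)
  show "inner (x + y) z = inner x z + inner y z"
    unfolding inner_poly_mapping_superset[OF fin keys_add, of z]
      inner_poly_mapping_superset[OF fin Un_upper1, of z]
      inner_poly_mapping_superset[OF fin Un_upper2, of z]
    by (simp only: lookup_add inner_add_left sum.distrib)
  have "Poly_Mapping.keys (r *\<^sub>R x) \<subseteq> Poly_Mapping.keys x"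
    by (auto simp: in_keys_iff scaleR_poly_mapping.rep_eq)
  then show "inner (r *\<^sub>R x) y = r * inner x y"
    using inner_poly_mapping_superset[of "Poly_Mapping.keys x" "r *\<^sub>R x" y]
    by (simp add: inner_poly_mapping_def[of x] scaleR_poly_mapping.rep_eq sum_distrib_left)
  show "0 \<le> inner x x"
    unfolding inner_poly_mapping_def by (rule sum_nonneg) simp
  show "(inner x x = 0) = (x = 0)"
  proof
    assume "inner x x = 0"
    then have "Poly_Mapping.lookup x k = 0" if "k \<in> Poly_Mapping.keys x" for k
      using that by (simp add: inner_poly_mapping_def sum_nonneg_eq_0_iff)
    then show "x = 0"
      by (metis in_keys_iff keys_eq_empty subsetI subset_empty)
  qed (simp add: inner_poly_mapping_def)
  show "norm x = sqrt (inner x x)"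
    by (rule norm_poly_mapping_def)
qed

end

section \<open>Euclidean n-space\<close>

type_synonym rvec = "nat \<Rightarrow>\<^sub>0 real"

definition Rn :: "nat \<Rightarrow> rvec set"
  where "Rn n = {x. Poly_Mapping.keys x \<subseteq> {..<n}}"

lemma inner_Rn:
  assumes "x \<in> Rn n"
  shows "inner x y = (\<Sum>j<n. Poly_Mapping.lookup x j * Poly_Mapping.lookup y j)"
  using inner_poly_mapping_superset[of "{..<n}" x y] assms by (simp add: Rn_def)

lemma norm_Rn:
  assumes "x \<in> Rn n"
  shows "norm x = sqrt (\<Sum>j<n. (Poly_Mapping.lookup x j)\<^sup>2)"
  using inner_Rn[OF assms, of x] by (simp add: norm_eq_sqrt_inner power2_eq_square)

lemma subspace_Rn: "subspace (Rn n)"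
  unfolding subspace_def Rn_def
proof (intro conjI ballI allI)
  show "0 \<in> {x::rvec. Poly_Mapping.keys x \<subseteq> {..<n}}"
    by simp
  show "x + y \<in> {x. Poly_Mapping.keys x \<subseteq> {..<n}}"
    if "x \<in> {x. Poly_Mapping.keys x \<subseteq> {..<n}}" "y \<in> {x. Poly_Mapping.keys x \<subseteq> {..<n}}"
    for x y :: rvec
    using that keys_add[of x y] by blast
  show "c *\<^sub>R x \<in> {x. Poly_Mapping.keys x \<subseteq> {..<n}}"
    if "x \<in> {x. Poly_Mapping.keys x \<subseteq> {..<n}}" for x :: rvec and c :: real
    using that by (auto simp: subset_iff in_keys_iff scaleR_poly_mapping.rep_eq)
qed

text \<open>
  f is continuously differentiable on n-space with gradient g; the condition
  "g x \<in> Rn n" makes g uniquely determined by f on n-space.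
\<close>

definition C1_with_gradient :: "nat \<Rightarrow> (rvec \<Rightarrow> real) \<Rightarrow> (rvec \<Rightarrow> rvec) \<Rightarrow> bool"
  where "C1_with_gradient n f g \<longleftrightarrow>
    (\<forall>x \<in> Rn n. g x \<in> Rn n \<and> (f has_derivative (\<lambda>h. inner (g x) h)) (at x within Rn n)) \<and>
    continuous_on (Rn n) g"

section \<open>The criticality measure\<close>

text \<open>
  Objectives are indexed by {1..m}; g i is the gradient of the i-th objective.
  The direction search_dir m \<Omega> g x is the s(x) of the method: x is
  epsilon-approximate Pareto critical iff norm (search_dir m \<Omega> g x) \<le> epsilon.
\<close>

definition shifted :: "rvec set \<Rightarrow> rvec \<Rightarrow> rvec set"
  where "shifted \<Omega> x = {y. y + x \<in> \<Omega>}"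

definition max_slope :: "nat \<Rightarrow> (nat \<Rightarrow> rvec \<Rightarrow> rvec) \<Rightarrow> rvec \<Rightarrow> rvec \<Rightarrow> real"
  where "max_slope m g x d = Max ((\<lambda>i. inner (g i x) d) ` {1..m})"

definition search_dir :: "nat \<Rightarrow> rvec set \<Rightarrow> (nat \<Rightarrow> rvec \<Rightarrow> rvec) \<Rightarrow> rvec \<Rightarrow> rvec"
  where "search_dir m \<Omega> g x =
    (THE d. is_arg_min (\<lambda>d. max_slope m g x d + 1 / 2 * (norm d)\<^sup>2) (\<lambda>d. d \<in> shifted \<Omega> x) d)"

section \<open>The line search method\<close>

definition metropolis_term ::
    "(rvec \<Rightarrow> real) \<Rightarrow> real \<Rightarrow> real \<Rightarrow> real \<Rightarrow> rvec \<Rightarrow> rvec \<Rightarrow> real"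
  where "metropolis_term fi \<sigma>i \<gamma> t x xp = \<sigma>i * exp (- (max \<gamma> (fi xp - fi x) / t))"

definition accepted ::
    "nat \<Rightarrow> (nat \<Rightarrow> rvec \<Rightarrow> real) \<Rightarrow> (nat \<Rightarrow> rvec \<Rightarrow> rvec) \<Rightarrow>
     real \<Rightarrow> real \<Rightarrow> (nat \<Rightarrow> real) \<Rightarrow> real \<Rightarrow> real \<Rightarrow> rvec \<Rightarrow> rvec \<Rightarrow> nat \<Rightarrow> bool"
  where "accepted m f g \<beta> \<rho> \<sigma> \<gamma> t x d l \<longleftrightarrow>
    (let xp = x + \<beta> ^ l *\<^sub>R d in
      \<forall>i\<in>{1..m}. f i xp \<le> f i x + \<rho> * \<beta> ^ l * inner (g i x) d
                           + metropolis_term (f i) (\<sigma> i) \<gamma> t x xp)"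

text \<open>
  x k, d k and l k are the iterate, the chosen direction and the number of
  backtracking steps at iteration k.
\<close>

definition metropolis_method ::
    "nat \<Rightarrow> rvec set \<Rightarrow> (nat \<Rightarrow> rvec \<Rightarrow> real) \<Rightarrow> (nat \<Rightarrow> rvec \<Rightarrow> rvec) \<Rightarrow>
     real \<Rightarrow> real \<Rightarrow> real \<Rightarrow> real \<Rightarrow> (nat \<Rightarrow> real) \<Rightarrow> real \<Rightarrow> (nat \<Rightarrow> real) \<Rightarrow>
     (nat \<Rightarrow> rvec) \<Rightarrow> (nat \<Rightarrow> rvec) \<Rightarrow> (nat \<Rightarrow> nat) \<Rightarrow> bool"
  where "metropolis_method m \<Omega> f g c1 c2 \<beta> \<rho> \<sigma> \<gamma> \<tau> x d l \<longleftrightarrow>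
    x 0 \<in> \<Omega> \<and>
    (\<forall>k. d k \<in> shifted \<Omega> (x k) \<and>
         max_slope m g (x k) (d k) \<le> - c1 * (norm (search_dir m \<Omega> g (x k)))\<^sup>2 \<and>
         norm (d k) \<le> c2 * norm (search_dir m \<Omega> g (x k)) \<and>
         accepted m f g \<beta> \<rho> \<sigma> \<gamma> (\<tau> k) (x k) (d k) (l k) \<and>
         (\<forall>l' < l k. \<not> accepted m f g \<beta> \<rho> \<sigma> \<gamma> (\<tau> k) (x k) (d k) l') \<and>
         x (Suc k) = x k + \<beta> ^ l k *\<^sub>R d k)"

text \<open>
  At k = 0 this is 1 / 0 = 0, and the exponent "max / 0" in the Metropolis term is
  then 0 as well: exactly the convention that the inverse temperature at k = 0 is ln 1 = 0.
\<close>

definition log_cooling :: "nat \<Rightarrow> real"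
  where "log_cooling k = 1 / ln (real k + 1)"

end

(*
  The Metropolis terms are at most sigma_i (k + 1)^(-gamma), hence summable, so summing the
  acceptance condition bounds the sum of alpha_k |s(x_k)|^2 independently of the number of
  iterations. Conversely, if backtracking occurred, the trial step alpha_k / beta was rejected, and
  the Hoelder descent inequality forces alpha_k |s(x_k)|^2 to be at least a constant times
  |s(x_k)|^(1 + 1 / theta_i) for some i. As epsilon < 1, each of the first T terms of the sum is
  therefore at least a constant times epsilon^(1 + 1 / theta_min).
*)

theory Submission
  imports Defs
begin

text \<open>The mean value theorem for \<open>f\<close> along the segment, which convexity keeps
  inside \<open>S\<close>, gives a gradient at some intermediate point; Cauchy-Schwarz and the
  Hoelder condition compare it with \<open>g x\<close>. Integrating along the segment would sharpen
  the constant by the factor 1 / (1 + \<theta>), which does not affect the order of the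
  bound.\<close>

lemma hoelder_gradient_descent:
  fixes f :: "'a::real_inner \<Rightarrow> real"
  assumes "convex S" "x \<in> S" "x + d \<in> S"
    and deriv: "\<And>y. y \<in> S \<Longrightarrow> (f has_derivative (\<lambda>h. inner (g y) h)) (at y within S)"
    and hoelder: "\<And>y z. y \<in> S \<Longrightarrow> z \<in> S \<Longrightarrow> norm (g y - g z) \<le> H * norm (z - y) powr \<theta>"
    and "0 \<le> H" "0 \<le> \<theta>" "0 \<le> t" "t \<le> 1"
  shows "f (x + t *\<^sub>R d) \<le> f x + t * inner (g x) d + t * (H * (t * norm d) powr \<theta> * norm d)"
proof -
  have seg: "x + u *\<^sub>R d \<in> S" if "0 \<le> u" "u \<le> 1" for u
    using convexD_alt[OF assms(1-3) that] by (simp add: algebra_simps)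
  have "((\<lambda>u. f (x + u *\<^sub>R d)) has_derivative (\<lambda>h. inner (g (x + u *\<^sub>R d)) (h *\<^sub>R d)))
      (at u within {0..t})" if "u \<in> {0..t}" for u
  proof -
    have line: "((\<lambda>u. x + u *\<^sub>R d) has_derivative (\<lambda>h. h *\<^sub>R d)) (at u within {0..t})"
      by (auto intro!: derivative_eq_intros)
    have "(\<lambda>u. x + u *\<^sub>R d) ` {0..t} \<subseteq> S"
      using seg \<open>t \<le> 1\<close> by auto
    moreover have "x + u *\<^sub>R d \<in> S"
      using that seg \<open>t \<le> 1\<close> by simp
    ultimately show ?thesis
      using has_derivative_in_compose[OF line has_derivative_subset[OF deriv]] by auto
  qed
  from mvt_very_simple[OF \<open>0 \<le> t\<close> this] obtain u where u: "u \<in> {0..t}"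
    and eq: "f (x + t *\<^sub>R d) - f (x + 0 *\<^sub>R d) = inner (g (x + u *\<^sub>R d)) ((t - 0) *\<^sub>R d)"
    by auto
  have "inner (g (x + u *\<^sub>R d) - g x) d \<le> norm (g (x + u *\<^sub>R d) - g x) * norm d"
    by (rule norm_cauchy_schwarz)
  also have "\<dots> \<le> H * (t * norm d) powr \<theta> * norm d"
  proof (rule mult_right_mono)
    have "norm (g (x + u *\<^sub>R d) - g x) \<le> H * (u * norm d) powr \<theta>"
      using hoelder[OF seg[of u] \<open>x \<in> S\<close>] u \<open>t \<le> 1\<close> by simp
    \<comment> \<open>The position \<open>u\<close> of the mean value point is unknown, but
      \<open>u\<close> is at most \<open>t\<close>.\<close>
    also have "\<dots> \<le> H * (t * norm d) powr \<theta>"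
      using u assms(6-8) by (intro mult_left_mono powr_mono2 mult_right_mono) auto
    finally show "norm (g (x + u *\<^sub>R d) - g x) \<le> H * (t * norm d) powr \<theta>" .
  qed simp
  finally have "t * (inner (g (x + u *\<^sub>R d)) d - inner (g x) d)
      \<le> t * (H * (t * norm d) powr \<theta> * norm d)"
    using \<open>0 \<le> t\<close> by (simp add: inner_diff_left mult_left_mono)
  with eq show ?thesis
    by (simp add: right_diff_distrib)
qed

text \<open>Solves the inequality left by a failed descent test for the step \<open>t\<close>:
  divide by \<open>H * c * s\<close>, take the root of order \<theta>, then multiply by
  \<open>s / c\<close> to turn \<open>t * (c * s)\<close> into \<open>t * s\<^sup>2\<close>.\<close>

lemma hoelder_step_lower_bound:
  fixes a H c s t \<theta> :: real
  assumes "0 < a" "0 < H" "0 < c" "0 < s" "0 < t" "0 < \<theta>"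
    and le: "a * s\<^sup>2 \<le> H * (t * (c * s)) powr \<theta> * (c * s)"
  shows "(a / (H * c)) powr (1 / \<theta>) / c * s powr (1 + 1 / \<theta>) \<le> t * s\<^sup>2"
proof -
  have "a / (H * c) * s \<le> (t * (c * s)) powr \<theta>"
    using le assms by (simp add: field_simps power2_eq_square)
  then have "(a / (H * c) * s) powr (1 / \<theta>) \<le> ((t * (c * s)) powr \<theta>) powr (1 / \<theta>)"
    using assms by (intro powr_mono2) auto
  also have "\<dots> = t * (c * s)"
    using assms by (simp add: powr_powr)
  finally have "(a / (H * c)) powr (1 / \<theta>) * s powr (1 / \<theta>) * (s / c) \<le> t * (c * s) * (s / c)"
    using assms by (intro mult_right_mono) (simp_all flip: powr_mult)
  moreover have "s powr (1 + 1 / \<theta>) = s * s powr (1 / \<theta>)"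
    using assms by (simp add: powr_add)
  moreover have "t * (c * s) * (s / c) = t * s\<^sup>2"
    using assms by (simp add: power2_eq_square)
  ultimately show ?thesis
    by (simp add: mult_ac)
qed

lemma metropolis_term_nonneg: "0 \<le> \<sigma>i \<Longrightarrow> 0 \<le> metropolis_term fi \<sigma>i \<gamma> t x xp"
  by (simp add: metropolis_term_def)

text \<open>Since \<open>ln (k + 1)\<close> is nonnegative, replacing the maximum by \<gamma> can
  only enlarge the term, and exp(-\<gamma> ln(k + 1)) is a power of k + 1.\<close>

lemma metropolis_term_log_cooling_le:
  assumes "0 \<le> \<sigma>i"
  shows "metropolis_term fi \<sigma>i \<gamma> (log_cooling k) x xp \<le> \<sigma>i * real (Suc k) powr (- \<gamma>)"
proof -
  \<comment> \<open>This also covers \<open>k = 0\<close>, where division by zero makes both sides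
    0.\<close>
  have "max \<gamma> (fi xp - fi x) / log_cooling k = max \<gamma> (fi xp - fi x) * ln (real (Suc k))"
    by (simp add: log_cooling_def add.commute)
  moreover have "\<gamma> * ln (real (Suc k)) \<le> max \<gamma> (fi xp - fi x) * ln (real (Suc k))"
    by (intro mult_right_mono) auto
  ultimately show ?thesis
    unfolding metropolis_term_def powr_def
    by (intro mult_left_mono[OF _ assms]) (simp del: of_nat_Suc)
qed

lemma inner_le_max_slope: "i \<in> {1..m} \<Longrightarrow> inner (g i x) d \<le> max_slope m g x d"
  unfolding max_slope_def by (rule Max_ge) auto

text \<open>Here \<open>s\<close> stands for the norm of the search direction. Either the full step
  is taken, or the trial with exponent \<open>l - 1\<close> was rejected by some objective; that
  objective supplies the index \<open>i\<close>.\<close>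

lemma accepted_step_lower_bound:
  fixes S :: "rvec set"
  assumes "convex S" "x \<in> S" "x + d \<in> S"
    and deriv: "\<And>i y. i \<in> {1..m} \<Longrightarrow> y \<in> S \<Longrightarrow>
      (f i has_derivative (\<lambda>h. inner (g i y) h)) (at y within S)"
    and hoelder: "\<And>i y z. i \<in> {1..m} \<Longrightarrow> y \<in> S \<Longrightarrow> z \<in> S \<Longrightarrow>
      norm (g i y - g i z) \<le> H i * norm (z - y) powr \<theta> i"
    and pos: "0 < c1" "0 < c2" "0 < \<beta>" "\<beta> < 1" "\<rho> < 1" "0 < s"
    and \<sigma>: "\<And>i. i \<in> {1..m} \<Longrightarrow> 0 \<le> \<sigma> i"
    and \<theta>: "\<And>i. i \<in> {1..m} \<Longrightarrow> 0 < \<theta> i"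
    and H: "\<And>i. i \<in> {1..m} \<Longrightarrow> 0 < H i"
    and slope: "max_slope m g x d \<le> - c1 * s\<^sup>2"
    and norm_d: "norm d \<le> c2 * s"
    and rejected: "\<forall>l' < l. \<not> accepted m f g \<beta> \<rho> \<sigma> \<gamma> t x d l'"
  shows "l = 0 \<or> (\<exists>i\<in>{1..m}.
    \<beta> * (((1 - \<rho>) * c1 / (H i * c2)) powr (1 / \<theta> i) / c2) * s powr (1 + 1 / \<theta> i) \<le> \<beta> ^ l * s\<^sup>2)"
proof (cases l)
  case (Suc l')
  let ?u = "\<beta> ^ l'"
  have u: "0 < ?u" "?u \<le> 1"
    using pos by (auto intro: power_le_one)
  from rejected Suc obtain i where i: "i \<in> {1..m}"
    and "\<not> f i (x + ?u *\<^sub>R d) \<le> f i x + \<rho> * ?u * inner (g i x) d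
      + metropolis_term (f i) (\<sigma> i) \<gamma> t x (x + ?u *\<^sub>R d)"
    by (auto simp: accepted_def Let_def)
  \<comment> \<open>The Metropolis term only relaxes the test, so a rejected trial violates the
    monotone Armijo condition as well.\<close>
  then have "f i x + \<rho> * ?u * inner (g i x) d < f i (x + ?u *\<^sub>R d)"
    using metropolis_term_nonneg[OF \<sigma>[OF i], of "f i" \<gamma> t x "x + ?u *\<^sub>R d"] by linarith
  also have "\<dots> \<le> f i x + ?u * inner (g i x) d
      + ?u * (H i * (?u * norm d) powr \<theta> i * norm d)"
    using assms(1-3) deriv[OF i] hoelder[OF i] H[OF i] \<theta>[OF i] u
    by (intro hoelder_gradient_descent) auto
  finally have "?u * ((1 - \<rho>) * - inner (g i x) d) < ?u * (H i * (?u * norm d) powr \<theta> i * norm d)"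
    by (simp add: algebra_simps)
  then have "(1 - \<rho>) * - inner (g i x) d < H i * (?u * norm d) powr \<theta> i * norm d"
    using u by (simp only: mult_less_cancel_left_pos)
  moreover have "(1 - \<rho>) * (c1 * s\<^sup>2) \<le> (1 - \<rho>) * - inner (g i x) d"
    using inner_le_max_slope[OF i, of g x d] slope pos by (intro mult_left_mono) auto
  moreover have "H i * (?u * norm d) powr \<theta> i * norm d \<le> H i * (?u * (c2 * s)) powr \<theta> i * (c2 * s)"
    using norm_d H[OF i] \<theta>[OF i] u
    by (intro mult_mono mult_left_mono powr_mono2) auto
  ultimately have "(1 - \<rho>) * c1 * s\<^sup>2 \<le> H i * (?u * (c2 * s)) powr \<theta> i * (c2 * s)"
    by (simp only: mult.assoc)
  then have "((1 - \<rho>) * c1 / (H i * c2)) powr (1 / \<theta> i) / c2 * s powr (1 + 1 / \<theta> i) \<le> ?u * s\<^sup>2"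
    using pos u H[OF i] \<theta>[OF i] by (intro hoelder_step_lower_bound) auto
  \<comment> \<open>The bound so far concerns the rejected step; one more factor \<beta> passes to
    the accepted one.\<close>
  then have "\<beta> * (((1 - \<rho>) * c1 / (H i * c2)) powr (1 / \<theta> i) / c2 * s powr (1 + 1 / \<theta> i))
      \<le> \<beta> * (?u * s\<^sup>2)"
    using pos by (intro mult_left_mono) auto
  with i Suc show ?thesis
    by (auto simp: mult.assoc)
qed simp

lemma powr_le_powr_of_le_one:
  fixes \<epsilon> s p q :: real
  assumes "0 < \<epsilon>" "\<epsilon> \<le> 1" "\<epsilon> \<le> s" "0 \<le> q" "q \<le> p"
  shows "\<epsilon> powr p \<le> s powr q"
proof -
  have "\<epsilon> powr p \<le> \<epsilon> powr q"
    using assms by (intro powr_mono') auto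
  also have "\<dots> \<le> s powr q"
    using assms by (intro powr_mono2) auto
  finally show ?thesis .
qed

text \<open>Each new iterate is a convex combination of \<open>x k\<close> and
  \<open>x k + d k\<close>, with weight \<open>\<beta> ^ l k\<close> at most 1.\<close>

lemma metropolis_method_in_feasible_set:
  assumes "metropolis_method m \<Omega> f g c1 c2 \<beta> \<rho> \<sigma> \<gamma> \<tau> x d l" "convex \<Omega>" "0 \<le> \<beta>" "\<beta> \<le> 1"
  shows "x k \<in> \<Omega>"
proof (induction k)
  case 0
  show ?case
    using assms(1) by (simp add: metropolis_method_def)
next
  case (Suc k)
  have "x k + d k \<in> \<Omega>" and step: "x (Suc k) = x k + \<beta> ^ l k *\<^sub>R d k"
    using assms(1) by (simp_all add: metropolis_method_def shifted_def add.commute)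
  from convexD_alt[OF \<open>convex \<Omega>\<close> Suc.IH this(1), of "\<beta> ^ l k"] show ?case
    using assms(3,4) unfolding step by (simp add: algebra_simps power_le_one)
qed

text \<open>The acceptance conditions for one objective telescope, with each slope bounded by
  \<open>- c1\<close> times the squared norm of the search direction.\<close>

lemma metropolis_method_sum_le:
  assumes run: "metropolis_method m \<Omega> f g c1 c2 \<beta> \<rho> \<sigma> \<gamma> log_cooling x d l"
    and i: "i \<in> {1..m}" and "0 \<le> \<sigma> i" "0 \<le> \<rho>" "0 \<le> \<beta>"
  shows "\<rho> * c1 * (\<Sum>k<T. \<beta> ^ l k * (norm (search_dir m \<Omega> g (x k)))\<^sup>2)
    \<le> f i (x 0) - f i (x T) + \<sigma> i * (\<Sum>k<T. real (Suc k) powr (- \<gamma>))"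
proof (induction T)
  case (Suc k)
  let ?s = "norm (search_dir m \<Omega> g (x k))"
  have "f i (x (Suc k)) \<le> f i (x k) + \<rho> * \<beta> ^ l k * inner (g i (x k)) (d k)
      + metropolis_term (f i) (\<sigma> i) \<gamma> (log_cooling k) (x k) (x (Suc k))"
    and slope: "max_slope m g (x k) (d k) \<le> - c1 * ?s\<^sup>2"
    using run i by (simp_all add: metropolis_method_def accepted_def Let_def)
  moreover have "\<rho> * \<beta> ^ l k * inner (g i (x k)) (d k) \<le> \<rho> * \<beta> ^ l k * (- c1 * ?s\<^sup>2)"
    using inner_le_max_slope[OF i, of g "x k" "d k"] slope assms(4,5)
    by (intro mult_left_mono) auto
  moreover note metropolis_term_log_cooling_le[OF \<open>0 \<le> \<sigma> i\<close>, of "f i" \<gamma> k "x k" "x (Suc k)"]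
  ultimately show ?case
    using Suc.IH by (simp add: algebra_simps)
qed simp

text \<open>\<open>C\<close> is chosen before the dimension, the problem and the run, so it can
  depend on the objectives only through \<sigma>, \<theta>, \<open>H\<close> and the initial gaps
  \<Delta>.\<close>

theorem mainTheorem7:
  fixes m :: nat
    and c1 c2 \<beta> \<rho> \<gamma> :: real
    and \<sigma> \<theta> H \<Delta> :: "nat \<Rightarrow> real"
  assumes "1 \<le> m"
    and "0 < c1" "0 < c2"
    and "0 < \<beta>" "\<beta> < 1"
    and "0 < \<rho>" "\<rho> < 1"
    and "1 < \<gamma>"
    and "\<And>i. i \<in> {1..m} \<Longrightarrow> 0 \<le> \<sigma> i"
    and "\<And>i. i \<in> {1..m} \<Longrightarrow> 0 < \<theta> i \<and> \<theta> i \<le> 1"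
    and "\<And>i. i \<in> {1..m} \<Longrightarrow> 0 < H i"
  shows "\<exists>C>0.
    \<forall>(n::nat) (\<Omega> :: rvec set) (f :: nat \<Rightarrow> rvec \<Rightarrow> real) (g :: nat \<Rightarrow> rvec \<Rightarrow> rvec)
      (fstar :: nat \<Rightarrow> real) (x :: nat \<Rightarrow> rvec) (d :: nat \<Rightarrow> rvec) (l :: nat \<Rightarrow> nat).
      1 \<le> n \<longrightarrow>
      \<Omega> \<subseteq> Rn n \<longrightarrow> \<Omega> \<noteq> {} \<longrightarrow> closed \<Omega> \<longrightarrow> convex \<Omega> \<longrightarrow>
      (\<forall>i\<in>{1..m}. C1_with_gradient n (f i) (g i)) \<longrightarrow>
      (\<forall>i\<in>{1..m}. \<forall>y\<in>\<Omega>. \<forall>z\<in>\<Omega>. norm (g i y - g i z) \<le> H i * norm (z - y) powr \<theta> i) \<longrightarrow>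
      (\<forall>i\<in>{1..m}. \<forall>y\<in>\<Omega>. fstar i \<le> f i y) \<longrightarrow>
      metropolis_method m \<Omega> f g c1 c2 \<beta> \<rho> \<sigma> \<gamma> log_cooling x d l \<longrightarrow>
      (\<forall>i\<in>{1..m}. f i (x 0) - fstar i = \<Delta> i) \<longrightarrow>
      (\<forall>(\<epsilon>::real) (T::nat). 0 < \<epsilon> \<longrightarrow> \<epsilon> < 1 \<longrightarrow>
         (\<forall>k<T. norm (search_dir m \<Omega> g (x k)) > \<epsilon>) \<longrightarrow>
         real T \<le> C * \<epsilon> powr (- (1 + 1 / Min (\<theta> ` {1..m}))))"
proof -
  define p where "p = 1 + 1 / Min (\<theta> ` {1..m})"
  \<comment> \<open>\<open>K i\<close> is the constant of \<open>accepted_step_lower_bound\<close>;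
    the minimum with 1 in \<kappa> handles full steps. In \<open>D\<close>, the absolute value and
    the summand 1 ensure positivity whatever the sign of \<open>\<Delta> 1\<close>.\<close>
  define K where "K i = \<beta> * (((1 - \<rho>) * c1 / (H i * c2)) powr (1 / \<theta> i) / c2)" for i
  define \<kappa> where "\<kappa> = min 1 (Min (K ` {1..m}))"
  define D where "D = \<bar>\<Delta> 1\<bar> + \<sigma> 1 * suminf (\<lambda>k. real (Suc k) powr (- \<gamma>)) + 1"
  note \<sigma> = assms(9) and \<theta> = assms(10) and H = assms(11)
  have one: "1 \<in> {1..m}"
    using \<open>1 \<le> m\<close> by simp
  have "0 < K i" if "i \<in> {1..m}" for i
    using H[OF that] assms(2-7) by (simp add: K_def)
  then have \<kappa>: "0 < \<kappa>" "\<kappa> \<le> 1"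
    using one by (auto simp: \<kappa>_def)
  have \<kappa>K: "\<kappa> \<le> K i" if "i \<in> {1..m}" for i
    using that by (auto simp: \<kappa>_def intro: min.coboundedI2)
  have p: "1 + 1 / \<theta> i \<le> p" if "i \<in> {1..m}" for i
  proof -
    have "Min (\<theta> ` {1..m}) \<in> \<theta> ` {1..m}"
      using one by (intro Min_in) auto
    then have "0 < Min (\<theta> ` {1..m})"
      using \<theta> by auto
    moreover have "Min (\<theta> ` {1..m}) \<le> \<theta> i"
      using that by auto
    ultimately show ?thesis
      by (simp add: p_def frac_le)
  qed
  \<comment> \<open>As \<open>\<theta> 1\<close> is at most 1, \<open>p\<close> also dominates the
    exponent 2 that a full step produces.\<close>
  have "2 \<le> 1 + 1 / \<theta> 1"
    using \<theta>[OF one] by simp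
  with p[OF one] have p2: "2 \<le> p"
    by linarith
  \<comment> \<open>The condition \<gamma> > 1 makes the total Metropolis allowance finite.\<close>
  have summable: "summable (\<lambda>k. real (Suc k) powr (- \<gamma>))"
    using \<open>1 < \<gamma>\<close> summable_Suc_iff[of "\<lambda>k. real k powr (- \<gamma>)"]
    by (simp add: summable_real_powr_iff)
  have "0 \<le> suminf (\<lambda>k. real (Suc k) powr (- \<gamma>))"
    by (intro suminf_nonneg summable) simp
  then have D: "0 < D"
    using \<sigma>[OF one] by (auto simp: D_def intro: add_nonneg_pos)
  show ?thesis
    unfolding p_def[symmetric]
  \<comment> \<open>The witness comes from solving
    \<open>\<rho> * c1 * (T * (\<kappa> * \<epsilon> powr p)) \<le> D\<close> for
    \<open>T\<close>.\<close>
  proof (intro exI[of _ "D / (\<rho> * c1 * \<kappa>)"] conjI allI impI)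
    show "0 < D / (\<rho> * c1 * \<kappa>)"
      using D \<kappa> assms(2,6) by simp
  next
    fix n \<Omega> f g fstar x d l \<epsilon> T
    assume "\<Omega> \<subseteq> Rn n" "convex \<Omega>"
      and C1: "\<forall>i\<in>{1..m}. C1_with_gradient n (f i) (g i)"
      and hoelder: "\<forall>i\<in>{1..m}. \<forall>y\<in>\<Omega>. \<forall>z\<in>\<Omega>. norm (g i y - g i z) \<le> H i * norm (z - y) powr \<theta> i"
      and lower: "\<forall>i\<in>{1..m}. \<forall>y\<in>\<Omega>. fstar i \<le> f i y"
      and run: "metropolis_method m \<Omega> f g c1 c2 \<beta> \<rho> \<sigma> \<gamma> log_cooling x d l"
      and \<Delta>: "\<forall>i\<in>{1..m}. f i (x 0) - fstar i = \<Delta> i"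
      and \<epsilon>: "0 < (\<epsilon>::real)" "\<epsilon> < 1"
      and large: "\<forall>k<T. \<epsilon> < norm (search_dir m \<Omega> g (x k))"
    have deriv: "(f i has_derivative (\<lambda>h. inner (g i y) h)) (at y within \<Omega>)"
      if "i \<in> {1..m}" "y \<in> \<Omega>" for i y
    proof (rule has_derivative_subset[OF _ \<open>\<Omega> \<subseteq> Rn n\<close>])
      have "y \<in> Rn n"
        using that(2) \<open>\<Omega> \<subseteq> Rn n\<close> by blast
      then show "(f i has_derivative (\<lambda>h. inner (g i y) h)) (at y within Rn n)"
        using C1 that(1) unfolding C1_with_gradient_def by blast
    qed
    have feasible: "x k \<in> \<Omega>" for k
      using metropolis_method_in_feasible_set[OF run \<open>convex \<Omega>\<close>] assms(4,5) by simp
    have term_ge: "\<kappa> * \<epsilon> powr p \<le> \<beta> ^ l k * (norm (search_dir m \<Omega> g (x k)))\<^sup>2" if "k < T" for k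
    proof -
      let ?s = "norm (search_dir m \<Omega> g (x k))"
      have s: "\<epsilon> < ?s" "0 < ?s"
        using large that \<epsilon> by (auto intro: less_trans)
      have "x k + d k \<in> \<Omega>"
        using run by (simp add: metropolis_method_def shifted_def add.commute)
      moreover have "max_slope m g (x k) (d k) \<le> - c1 * ?s\<^sup>2" "norm (d k) \<le> c2 * ?s"
        "\<forall>l' < l k. \<not> accepted m f g \<beta> \<rho> \<sigma> \<gamma> (log_cooling k) (x k) (d k) l'"
        using run by (auto simp: metropolis_method_def)
      ultimately have "l k = 0 \<or> (\<exists>i\<in>{1..m}. K i * ?s powr (1 + 1 / \<theta> i) \<le> \<beta> ^ l k * ?s\<^sup>2)"
        unfolding K_def
        using \<open>convex \<Omega>\<close> feasible deriv hoelder assms(2-7) s(2) \<sigma> \<theta> H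
        by (intro accepted_step_lower_bound) auto
      then show ?thesis
      proof
        assume "l k = 0"
        have "\<kappa> * \<epsilon> powr p \<le> 1 * ?s powr 2"
          using \<kappa> \<epsilon> s p2 by (intro mult_mono powr_le_powr_of_le_one) auto
        with \<open>l k = 0\<close> s show ?thesis
          by simp
      next
        assume "\<exists>i\<in>{1..m}. K i * ?s powr (1 + 1 / \<theta> i) \<le> \<beta> ^ l k * ?s\<^sup>2"
        then obtain i where i: "i \<in> {1..m}"
          and ge: "K i * ?s powr (1 + 1 / \<theta> i) \<le> \<beta> ^ l k * ?s\<^sup>2" by blast
        \<comment> \<open>The index \<open>i\<close> varies with \<open>k\<close>; \<kappa> and
          \<open>p\<close> make the bound uniform, because \<epsilon> < 1 lets the exponent grow to
          \<open>p\<close>.\<close>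
        have "\<kappa> * \<epsilon> powr p \<le> K i * ?s powr (1 + 1 / \<theta> i)"
          using \<kappa> \<kappa>K[OF i] \<epsilon> s p[OF i] \<theta>[OF i]
          by (intro mult_mono powr_le_powr_of_le_one) auto
        with ge show ?thesis
          by linarith
      qed
    qed
    have "real T * (\<kappa> * \<epsilon> powr p) \<le> (\<Sum>k<T. \<beta> ^ l k * (norm (search_dir m \<Omega> g (x k)))\<^sup>2)"
      using sum_bounded_below[of "{..<T}" "\<kappa> * \<epsilon> powr p"] term_ge by simp
    then have "\<rho> * c1 * (real T * (\<kappa> * \<epsilon> powr p))
        \<le> \<rho> * c1 * (\<Sum>k<T. \<beta> ^ l k * (norm (search_dir m \<Omega> g (x k)))\<^sup>2)"
      using assms(2,6) by (intro mult_left_mono) auto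
    \<comment> \<open>The sum on the left is the same for all objectives, so the estimate for a
      single one, here the first, bounds it.\<close>
    also have "\<dots> \<le> f 1 (x 0) - f 1 (x T) + \<sigma> 1 * (\<Sum>k<T. real (Suc k) powr (- \<gamma>))"
      using metropolis_method_sum_le[OF run one] \<sigma>[OF one] assms(4,6) by simp
    also have "\<dots> \<le> D"
    proof -
      have "f 1 (x 0) - f 1 (x T) \<le> \<bar>\<Delta> 1\<bar>"
        using \<Delta> lower feasible[of T] one by fastforce
      moreover have "\<sigma> 1 * (\<Sum>k<T. real (Suc k) powr (- \<gamma>)) \<le> \<sigma> 1 * suminf (\<lambda>k. real (Suc k) powr (- \<gamma>))"
        using summable \<sigma>[OF one] by (intro mult_left_mono sum_le_suminf) auto
      ultimately show ?thesis
        by (simp add: D_def)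
    qed
    finally show "real T \<le> D / (\<rho> * c1 * \<kappa>) * \<epsilon> powr (- p)"
      using \<kappa> \<epsilon> assms(2,6) by (simp add: powr_minus field_simps)
  qed
qed

end
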